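(* Let $\mathcal{H}$ be a real Hilbert space, let $n\in\mathbb{N}\smallsetminus\{0\}$ and $m=2n-1$. Let $U_1,\ldots,U_n$ be closed linear subspaces of $\mathcal{H}$ with $U_1^\perp+\cdots+U_n^\perp$ closed, and set $U_{n+i}:=U_{n-i}$ for every $i\in\{1,\ldots,n-1\}$. Let $\mathcal{S}$ be a finite set of operators with $\Psi\subseteq\mathcal{S}\subseteq\Omega$, where $$\Omega=\{\mathrm{R}_{U_{i_r}}\cdots\mathrm{R}_{U_{i_2}}\mathrm{R}_{U_{i_1}} : r\in\mathbb{N},\ i_1,\ldots,i_r\in\{1,\ldots,m\}\},$$ $$\Psi=\{\mathrm{R}_{U_{i_r}}\cdots\mathrm{R}_{U_{i_2}}\mathrm{R}_{U_{i_1}} : r\in\{0,1,\ldots,m\},\ i_1,\ldots,i_r\in\{1,\ldots,m\},\ i_1<\cdots<i_r\}.$$ Set $T:=\mathrm{P}_{U_m}\cdots\mathrm{P}_{U_1}=\mathrm{P}_{U_1}\cdots\mathrm{P}_{U_{n-1}}\mathrm{P}_{U_n}\mathrm{P}_{U_{n-1}}\cdots\mathrm{P}_{U_1}$, $c(T):=\|T\mathrm{P}_{(\operatorname{Fix}T)^\perp}\|$, $\gamma:=\|\mathrm{P}_{U_n}\mathrm{P}_{U_{n-1}}\cdots\mathrm{P}_{U_1}\mathrm{P}_{(\cap_{i=1}^mU_i)^\perp}\|$, $$c_1:=\inf\{\langle Tx,x\rangle : x\in(\operatorname{Fix}T)^\perp,\|x\|=1\},\qquad c_2:=\sup\{\langle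 Tx,x\rangle : x\in(\operatorname{Fix}T)^\perp,\|x\|=1\},$$ where $c_1:=c_2:=0$ if $(\operatorname{Fix}T)^\perp=\{0\}$, and $\eta:=\frac{c_2-c_1}{2-c_1-c_2}$. Then: (i) $0\le\eta\le\frac{c(T)}{2-c(T)}\le c(T)=\gamma^2<1$. (ii) For every $x\in\mathcal{H}$ and every $k\in\mathbb{N}$, $\|CC_{\mathcal{S}}^k(x)-\mathrm{P}_{\cap_{i=1}^nU_i}x\|\le\eta^k\,\|x-\mathrm{P}_{\cap_{i=1}^nU_i}x\|$.
   Context: $\mathbb{N}=\{0,1,2,\ldots\}$, and $\eta^0=1$ also for $\eta=0$. $\operatorname{Fix}T=\{x:Tx=x\}$. $\mathrm{P}_C$ is the projector (best approximation operator) onto $C$, and $\mathrm{R}_C=2\mathrm{P}_C-\mathrm{Id}$ is the reflector associated with $C$. The empty composition ($r=0$) is $\mathrm{Id}$. $C^\perp$ is the orthogonal complement; $\|\cdot\|$ of a bounded linear operator is the operator norm. Circumcenter mapping: for a finite set $\mathcal{S}$ of isometries of $\mathcal{H}$ having a common fixed point (such as a finite subset of $\Omega$), and $x\in\mathcal{H}$, let $\mathcal{S}(x)=\{Gx: G\in\mathcal{S}\}$. It is known that there is a unique point $CC_{\mathcal{S}}(x)$ that lies in the affine hull $\operatorname{aff}(\mathcal{S}(x))$ and is equidistant from all points of $\mathcal{S}(x)$; this defines the circumcenter mapping $CC_{\mathcal{S}}:\mathcal{H}\to\mathcal{H}$. $CC_{\mathcal{S}}^k$ is its $k$-fold composition.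 *)

theory Defs
  imports "HOL-Analysis.Analysis"
begin

text \<open>
  Real Hilbert spaces are types of sort \<open>{real_inner, complete_space}\<close>. The library's
  \<open>closest_point\<close> has the same defining formula as \<open>projector\<close>, but its type is restricted to
  \<open>heine_borel\<close>, i.e. to finite dimension. For a nonempty closed convex set in a Hilbert space
  the best approximation exists and is unique, so the choice operator is harmless.
\<close>

definition projector :: "'a::real_inner set \<Rightarrow> 'a \<Rightarrow> 'a" where
  "projector C x = (SOME p. p \<in> C \<and> (\<forall>y\<in>C. dist x p \<le> dist x y))"

definition reflector :: "'a::real_inner set \<Rightarrow> 'a \<Rightarrow> 'a" where
  "reflector C x = 2 *\<^sub>R projector C x - x"

definition Fix :: "('a \<Rightarrow> 'a) \<Rightarrow> 'a set" where
  "Fix T = {x. T x = x}"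

text \<open>
  The word \<open>[i1, \<dots>, ir]\<close> of indices denotes the composition \<open>A ir \<circ> \<dots> \<circ> A i1\<close>, in which the
  head of the list acts first; the empty word denotes the identity.
\<close>

definition comp_word :: "(nat \<Rightarrow> 'a \<Rightarrow> 'a) \<Rightarrow> nat list \<Rightarrow> 'a \<Rightarrow> 'a" where
  "comp_word A is = fold A is"

lemma comp_word_simps:
  "comp_word A [] = id"
  "comp_word A (i # is) = comp_word A is \<circ> A i"
  by (simp_all add: comp_word_def)

lemma comp_word_append: "comp_word A (is @ js) = comp_word A js \<circ> comp_word A is"
  by (simp add: comp_word_def)

definition Omega_set :: "(nat \<Rightarrow> 'a::real_inner set) \<Rightarrow> nat \<Rightarrow> ('a \<Rightarrow> 'a) set" where
  "Omega_set U m = {comp_word (\<lambda>i. reflector (U i)) is | is. set is \<subseteq> {1..m}}"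

definition Psi_set :: "(nat \<Rightarrow> 'a::real_inner set) \<Rightarrow> nat \<Rightarrow> ('a \<Rightarrow> 'a) set" where
  "Psi_set U m = {comp_word (\<lambda>i. reflector (U i)) is | is.
     length is \<le> m \<and> set is \<subseteq> {1..m} \<and> sorted_wrt (<) is}"

definition circumcenter_map :: "('a::real_inner \<Rightarrow> 'a) set \<Rightarrow> 'a \<Rightarrow> 'a" where
  "circumcenter_map S x = (THE p. p \<in> affine hull ((\<lambda>G. G x) ` S) \<and>
     (\<forall>y\<in>(\<lambda>G. G x) ` S. \<forall>z\<in>(\<lambda>G. G x) ` S. dist p y = dist p z))"

text \<open>
  The two expressions for \<open>T\<close> agree: \<open>P (U m) \<circ> \<dots> \<circ> P (U 1)\<close> equals
  \<open>P (U 1) \<circ> \<dots> \<circ> P (U (n-1)) \<circ> P (U n) \<circ> P (U (n-1)) \<circ> \<dots> \<circ> P (U 1)\<close>.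
\<close>

lemma comp_word_palindrome:
  assumes n: "n \<ge> 1" and U: "\<And>i. i \<in> {1..n-1} \<Longrightarrow> U (n+i) = U (n-i)"
  shows "comp_word (\<lambda>i. projector (U i)) [1..<Suc (2*n-1)] =
         comp_word (\<lambda>i. projector (U i)) ([1..<n] @ [n] @ rev [1..<n])"
proof -
  have "map U [1..<Suc (2*n-1)] = map U ([1..<n] @ [n] @ rev [1..<n])"
  proof (rule nth_equalityI)
    show "length (map U [1..<Suc (2*n-1)]) = length (map U ([1..<n] @ [n] @ rev [1..<n]))"
      using n by (simp del: upt_Suc)
  next
    fix j assume "j < length (map U [1..<Suc (2*n-1)])"
    then have j: "j < 2*n-1" by (simp del: upt_Suc)
    consider "j < n-1" | "j = n-1" | "j > n-1" by linarith
    then show "map U [1..<Suc (2*n-1)] ! j = map U ([1..<n] @ [n] @ rev [1..<n]) ! j"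
    proof cases
      case 3
      define i where "i = j - (n-1)"
      have i: "i \<in> {1..n-1}" "j = n-1+i" using 3 j by (auto simp: i_def)
      have "([1..<n] @ [n] @ rev [1..<n]) ! j = rev [1..<n] ! (i - 1)"
        using i by (auto simp: nth_append nth_Cons' simp del: upt_Suc)
      also have "\<dots> = n - i" using i by (auto simp: rev_nth simp del: upt_Suc)
      finally have "([1..<n] @ [n] @ rev [1..<n]) ! j = n - i" .
      moreover have "[1..<Suc (2*n-1)] ! j = n + i"
        using i j n by (auto simp del: upt_Suc)
      ultimately show ?thesis using U[OF i(1)] j n by (simp del: upt_Suc map_append add: nth_map)
    qed (use j n in \<open>auto simp: nth_append simp del: upt_Suc\<close>)
  qed
  then have "fold projector (map U [1..<Suc (2*n-1)]) =
             fold projector (map U ([1..<n] @ [n] @ rev [1..<n]))" by (rule arg_cong)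
  then show ?thesis by (simp only: comp_word_def fold_map comp_def)
qed

end

theory Submission
  imports Defs
begin

text \<open>
  Write \<open>W\<close> for the intersection of the subspaces, \<open>V = W\<^sup>\<bottom>\<close>, and \<open>A\<close> for the composition of the projectors
  onto \<open>U 1, \<dots>, U n\<close>. Since the list of subspaces is a palindrome, \<open>T = A\<^sup>* A\<close>. So \<open>T\<close> is symmetric and
  positive, its fixed points are the points of \<open>W\<close>, and it maps \<open>V\<close> into itself. On \<open>V\<close> the quadratic form
  of \<open>T\<close> is \<open>(norm (A v))\<^sup>2\<close> and its norm is the supremum of that form over unit vectors
  (\<open>norm_le_numerical_radius\<close>), whence \<open>c2 = cT = \<gamma>\<^sup>2\<close>. With \<open>0 \<le> c1 \<le> c2\<close> the inequalities between the rates are elementary.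

  That \<open>\<gamma> < 1\<close> is where closedness of the sum of the complements is used (\<open>proj_word_contracts\<close>). If \<open>A\<close>
  hardly shortens \<open>v \<in> V\<close>, then \<open>v\<close> is near to every \<open>U i\<close>, so it is nearly orthogonal to each fixed element
  of the sum, which is all of \<open>V\<close>. The uniform boundedness principle makes this uniform: such \<open>v\<close> are bounded
  by a multiple of the square root of the loss \<open>(norm v)\<^sup>2 - (norm (A v))\<^sup>2\<close>.

  For the circumcenter iteration, all operators in \<open>S\<close> are isometries that fix \<open>W\<close> pointwise. So the
  points \<open>G x\<close> lie on a sphere around \<open>w = projector W x\<close>, and the circumcenter is the point of
  their affine hull nearest to \<open>w\<close> (\<open>circumcenter_map_nearest\<close>). The hull contains \<open>x\<close> and also
  \<open>T x\<close>, which is an average of words from \<open>Psi_set\<close> (\<open>proj_word_in_affine_hull\<close>); hence it contains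
  every relaxation \<open>(1 - l) x + l T x\<close>. Choosing \<open>l\<close> so that the numerical range of the relaxation on \<open>V\<close>
  becomes symmetric about zero gives the distance bound with factor \<open>\<eta>\<close> (\<open>relaxation_norm_le\<close>). All
  points of the hull have the same projection onto \<open>W\<close>, so the estimate can be iterated.
\<close>

section \<open>Orthogonal projections in a Hilbert space\<close>

lemma orthogonal_comp_iff: "x \<in> V\<^sup>\<bottom> \<longleftrightarrow> (\<forall>y\<in>V. inner x y = 0)"
  by (auto simp: orthogonal_comp_def orthogonal_def inner_commute)

lemma closed_orthogonal_comp: "closed (V\<^sup>\<bottom>)"
proof -
  have "V\<^sup>\<bottom> = (\<Inter>y\<in>V. {x. inner x y = 0})" by (auto simp: orthogonal_comp_iff)
  moreover have "closed {x. inner x y = 0}" for y :: 'a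
    by (intro closed_Collect_eq continuous_intros)
  ultimately show ?thesis by auto
qed

text \<open>
  First variation: moving from the nearest point \<open>p\<close> along \<open>y\<close> by the optimal step
  \<open>\<langle>x - p, y\<rangle> / \<langle>y, y\<rangle>\<close> would shorten the distance unless that step is zero.
\<close>

lemma nearest_point_residual_orthogonal:
  fixes x :: "'a::real_inner"
  assumes V: "subspace V" and p: "p \<in> V" and min: "\<And>y. y \<in> V \<Longrightarrow> dist x p \<le> dist x y"
  shows "x - p \<in> V\<^sup>\<bottom>"
  unfolding orthogonal_comp_iff
proof
  fix y assume y: "y \<in> V"
  define t where "t = inner (x - p) y / inner y y"
  have "p + t *\<^sub>R y \<in> V" using V p y by (simp add: subspace_add subspace_scale)
  from min[OF this] have "(norm (x - p))\<^sup>2 \<le> (norm (x - p - t *\<^sub>R y))\<^sup>2"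
    by (simp add: dist_norm diff_diff_eq)
  then have "2 * t * inner (x - p) y \<le> t\<^sup>2 * inner y y"
    unfolding power2_norm_eq_inner
    by (simp add: inner_diff_left inner_diff_right inner_commute power2_eq_square algebra_simps)
  moreover have "t * inner y y = inner (x - p) y" by (cases "y = 0") (simp_all add: t_def)
  ultimately have "inner (x - p) y * inner (x - p) y \<le> 0" 
    by (cases "y = 0") (simp_all add: t_def power2_eq_square field_simps)
  then show "inner (x - p) y = 0" by (auto simp: mult_le_0_iff)
qed

text \<open>
  A minimising sequence in \<open>V\<close> is Cauchy because of the parallelogram law: two almost nearest points
  that were far apart would have a midpoint nearer to \<open>x\<close> than the infimum allows. Completeness and
  closedness then supply the limit. This is the step that replaces compactness of balls.
\<close>

lemma nearest_point_exists:
  fixes x :: "'a::{real_inner, complete_space}"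
  assumes V: "subspace V" and cl: "closed V"
  obtains p where "p \<in> V" "\<And>y. y \<in> V \<Longrightarrow> dist x p \<le> dist x y"
proof -
  have ne: "V \<noteq> {}" using V subspace_0 by blast
  define d where "d = infdist x V"
  have d0: "d \<ge> 0" by (simp add: d_def infdist_nonneg)
  have d_le: "d \<le> dist x y" if "y \<in> V" for y using that by (simp add: d_def infdist_le)
  have "\<exists>y\<in>V. (dist x y)\<^sup>2 < d\<^sup>2 + 1 / real (Suc k)" for k
  proof -
    have "d < sqrt (d\<^sup>2 + 1 / real (Suc k))" by (rule real_less_rsqrt) simp
    then have "Inf (dist x ` V) < sqrt (d\<^sup>2 + 1 / real (Suc k))"
      using infdist_notempty[OF ne, of x] by (simp add: d_def)
    then obtain y where "y \<in> V" "dist x y < sqrt (d\<^sup>2 + 1 / real (Suc k))"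
      using ne by (subst (asm) cInf_less_iff) (auto intro: bdd_belowI2[where m=0])
    then show ?thesis
      using power_strict_mono[of "dist x y" "sqrt (d\<^sup>2 + 1 / real (Suc k))" 2]
      by (auto intro!: bexI[of _ y])
  qed
  then obtain y where yV: "\<And>k. y k \<in> V" and yd: "\<And>k. (dist x (y k))\<^sup>2 < d\<^sup>2 + 1 / real (Suc k)"
    by metis
  have near: "(dist (y k) (y l))\<^sup>2 \<le> 2 / real (Suc k) + 2 / real (Suc l)" for k l
  proof -
    let ?z = "(1/2) *\<^sub>R (y k + y l)"
    have "?z \<in> V" using V yV by (simp add: subspace_add subspace_scale)
    then have "d\<^sup>2 \<le> (dist x ?z)\<^sup>2" using d_le d0 by (simp add: power_mono)
    moreover have "(dist (y k) (y l))\<^sup>2 = 2 * (dist x (y k))\<^sup>2 + 2 * (dist x (y l))\<^sup>2 - 4 * (dist x ?z)\<^sup>2"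
      unfolding dist_norm power2_norm_eq_inner
      by (simp add: inner_diff_left inner_diff_right inner_add_left inner_add_right inner_commute algebra_simps)
    ultimately show ?thesis using yd[of k] yd[of l] by simp
  qed
  have "Cauchy y"
  proof (rule metric_CauchyI)
    fix e :: real assume e: "e > 0"
    obtain N :: nat where N: "4 / e\<^sup>2 < real N" using reals_Archimedean2 by blast
    have "dist (y k) (y l) < e" if "k \<ge> N" "l \<ge> N" for k l
    proof -
      have "real (Suc j) > 4 / e\<^sup>2" if "j \<ge> N" for j using N that by linarith
      then have "2 / real (Suc j) < e\<^sup>2 / 2" if "j \<ge> N" for j
        using that e by (simp add: field_simps)
      then have "(dist (y k) (y l))\<^sup>2 < e\<^sup>2" using near[of k l] that by (smt (verit) field_sum_of_halves)
      then show ?thesis by (rule power2_less_imp_less) (use e in simp)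
    qed
    then show "\<exists>M. \<forall>k\<ge>M. \<forall>l\<ge>M. dist (y k) (y l) < e" by blast
  qed
  then obtain p where lim: "y \<longlonglongrightarrow> p" using Cauchy_convergent convergent_def by blast
  have pV: "p \<in> V" using closed_sequentially[OF cl] yV lim by blast
  have "(\<lambda>k. (dist x (y k))\<^sup>2) \<longlonglongrightarrow> (dist x p)\<^sup>2" by (intro tendsto_intros lim)
  moreover have "(\<lambda>k. d\<^sup>2 + 1 / real (Suc k)) \<longlonglongrightarrow> d\<^sup>2"
    using tendsto_add[OF tendsto_const LIMSEQ_inverse_real_of_nat] by (simp add: inverse_eq_divide)
  ultimately have "(dist x p)\<^sup>2 \<le> d\<^sup>2" using yd by (meson LIMSEQ_le less_imp_le)
  then have "dist x p \<le> d" using d0 power2_le_imp_le by blast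
  then show ?thesis using that pV d_le by force
qed

text \<open>
  The variational description of the best approximation. It turns every later identity about
  \<open>projector\<close> into an orthogonality check, since by Pythagoras a point with orthogonal residual is
  the only minimiser.
\<close>

lemma projector_eqI:
  fixes x :: "'a::real_inner"
  assumes V: "subspace V" and p: "p \<in> V" and orth: "x - p \<in> V\<^sup>\<bottom>"
  shows "projector V x = p"
proof -
  have pyth: "(dist x y)\<^sup>2 = (dist x p)\<^sup>2 + (dist p y)\<^sup>2" if "y \<in> V" for y
  proof -
    have "inner (x - p) (p - y) = 0"
      using orth V p that by (simp add: orthogonal_comp_iff subspace_diff)
    then show ?thesis
      using norm_add_Pythagorean[of "x - p" "p - y"] by (simp add: dist_norm orthogonal_def)
  qed
  show ?thesis
    unfolding projector_def
  proof (rule some_equality)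
    have "dist x p \<le> dist x y" if "y \<in> V" for y
      by (rule power2_le_imp_le) (simp_all add: pyth[OF that])
    then show "p \<in> V \<and> (\<forall>y\<in>V. dist x p \<le> dist x y)" using p by blast
    fix q assume q: "q \<in> V \<and> (\<forall>y\<in>V. dist x q \<le> dist x y)"
    then have "(dist x q)\<^sup>2 \<le> (dist x p)\<^sup>2" using p by (simp add: power_mono)
    then show "q = p" using pyth[of q] q by simp
  qed
qed

lemma projector_subspace:
  fixes V :: "'a::{real_inner, complete_space} set"
  assumes V: "subspace V" and cl: "closed V"
  shows projector_in: "projector V x \<in> V"
    and projector_residual: "x - projector V x \<in> V\<^sup>\<bottom>"
proof -
  obtain p where p: "p \<in> V" "\<And>y. y \<in> V \<Longrightarrow> dist x p \<le> dist x y"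
    using nearest_point_exists[OF V cl] by metis
  have r: "x - p \<in> V\<^sup>\<bottom>" using nearest_point_residual_orthogonal[OF V p] .
  then have "projector V x = p" using projector_eqI[OF V p(1)] by simp
  then show "projector V x \<in> V" "x - projector V x \<in> V\<^sup>\<bottom>" using p r by auto
qed

lemma projector_eq_midpoint: "projector V x = (1/2) *\<^sub>R x + (1/2) *\<^sub>R reflector V x"
  by (simp add: reflector_def algebra_simps)

context
  fixes V :: "'a::{real_inner, complete_space} set"
  assumes V: "subspace V" and cl: "closed V"
begin

lemma projector_fixed_iff: "projector V x = x \<longleftrightarrow> x \<in> V"
  using projector_in[OF V cl, of x] projector_eqI[OF V, of x x] subspace_0[OF subspace_orthogonal_comp[of V]] by auto

lemma projector_linear: "linear (projector V)"
proof (rule linearI)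
  note s = V subspace_orthogonal_comp[of V] projector_subspace[OF V cl]
  show "projector V (x + y) = projector V x + projector V y" for x y
    by (rule projector_eqI[OF V]) (auto simp: s subspace_add add_diff_add)
  show "projector V (c *\<^sub>R x) = c *\<^sub>R projector V x" for c x
    by (rule projector_eqI[OF V]) (auto simp: s subspace_scale simp flip: scaleR_diff_right)
qed

lemma inner_projector_left: "inner (projector V x) y = inner (projector V x) (projector V y)"
proof -
  have "inner (projector V x) (y - projector V y) = 0"
    using projector_in[OF V cl, of x] projector_residual[OF V cl, of y]
    by (auto simp: orthogonal_comp_iff inner_commute)
  then show ?thesis by (simp add: inner_diff_right)
qed

lemma projector_self_adjoint: "inner (projector V x) y = inner x (projector V y)"
  by (metis inner_commute inner_projector_left)

lemma norm_projector_Pythagoras: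
  "(norm x)\<^sup>2 = (norm (projector V x))\<^sup>2 + (norm (x - projector V x))\<^sup>2"
  using norm_add_Pythagorean[of "projector V x" "x - projector V x"]
    projector_in[OF V cl, of x] projector_residual[OF V cl, of x]
  by (simp add: orthogonal_comp_iff orthogonal_def inner_commute)

lemma norm_projector_le: "norm (projector V x) \<le> norm x"
  using norm_projector_Pythagoras[of x] by (simp add: power2_le_imp_le)

lemma orthogonal_comp_self_Hilbert: "V\<^sup>\<bottom>\<^sup>\<bottom> = V"
proof
  show "V\<^sup>\<bottom>\<^sup>\<bottom> \<subseteq> V"
  proof
    fix x assume x: "x \<in> V\<^sup>\<bottom>\<^sup>\<bottom>"
    let ?r = "x - projector V x"
    have "?r \<in> V\<^sup>\<bottom>\<^sup>\<bottom>"
      using x projector_in[OF V cl, of x] orthogonal_comp_subset[of V]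
      by (blast intro: subspace_diff subspace_orthogonal_comp)
    then have "inner ?r ?r = 0"
      using projector_residual[OF V cl, of x] by (auto simp: orthogonal_comp_iff)
    then show "x \<in> V" using projector_fixed_iff[of x] by simp
  qed
qed (rule orthogonal_comp_subset)

lemma reflector_self_adjoint: "inner (reflector V x) y = inner x (reflector V y)"
  by (simp add: reflector_def inner_diff_left inner_diff_right projector_self_adjoint)

lemma norm_reflector: "norm (reflector V x) = norm x"
proof -
  have "(norm (reflector V x))\<^sup>2 = (norm x)\<^sup>2"
    using inner_projector_left[of x x]
    unfolding power2_norm_eq_inner reflector_def
    by (simp add: inner_diff_left inner_diff_right inner_commute)
  then show ?thesis by simp
qed

lemma reflector_fixed: "x \<in> V \<Longrightarrow> reflector V x = x"
  using projector_fixed_iff[of x] by (simp add: reflector_def scaleR_2)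

end

section \<open>Closed sums of complements and uniform boundedness\<close>

text \<open>
  The uniform boundedness principle for the functionals \<open>\<lambda>y. \<langle>x, y\<rangle>\<close>. The closed sets of those
  \<open>y\<close> at which all of them are bounded by \<open>N\<close> cover the space, so by the Baire category theorem one of
  them contains a ball; testing \<open>x \<in> B\<close> against the centre and against the point of that ball in the
  direction of \<open>x\<close> bounds \<open>norm x\<close>.
\<close>

lemma weakly_bounded_imp_bounded:
  fixes B :: "'a::{real_inner, complete_space} set"
  assumes weak: "\<And>y. \<exists>C. \<forall>x\<in>B. \<bar>inner x y\<bar> \<le> C"
  shows "bounded B"
proof -
  define F where "F N = {y. \<forall>x\<in>B. \<bar>inner x y\<bar> \<le> real N}" for N :: nat
  have closed_F: "closed (F N)" for N
  proof -
    have "F N = (\<Inter>x\<in>B. {y. \<bar>inner x y\<bar> \<le> real N})" by (auto simp: F_def)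
    moreover have "closed {y. \<bar>inner x y\<bar> \<le> real N}" for x :: 'a
      by (intro closed_Collect_le continuous_intros)
    ultimately show ?thesis by auto
  qed
  have cover: "\<Union>(range F) = UNIV"
  proof -
    have "y \<in> \<Union>(range F)" for y
    proof -
      obtain C where C: "\<forall>x\<in>B. \<bar>inner x y\<bar> \<le> C" using weak by blast
      obtain N where "C \<le> real N" using real_arch_simple by blast
      with C have "y \<in> F N" unfolding F_def by force
      then show ?thesis by blast
    qed
    then show ?thesis by blast
  qed
  have "\<exists>N. interior (F N) \<noteq> {}"
  proof (rule ccontr)
    assume "\<nexists>N. interior (F N) \<noteq> {}"
    then have "euclidean interior_of \<Union>(range F) = {}"
      using Met_TC.metric_Baire_category_alt[where 'a='a, of "range F"] closed_F complete_UNIV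
      by (auto simp: mcomplete_iff_complete)
    then show False by (simp add: cover)
  qed
  then obtain N y0 r where r: "r > 0" and sub: "cball y0 r \<subseteq> F N"
    by (metis ex_in_conv mem_interior_cball)
  have "norm x \<le> 2 * real N / r" if x: "x \<in> B" for x
  proof (cases "x = 0")
    case False
    \<comment> \<open>On the boundary of the ball, in the direction of \<open>x\<close>.\<close>
    define y where "y = y0 + (r / norm x) *\<^sub>R x"
    have "y \<in> cball y0 r" "y0 \<in> cball y0 r" using r False by (auto simp: y_def dist_norm)
    then have "y \<in> F N" "y0 \<in> F N" using sub by blast+
    then have "\<bar>inner x y\<bar> \<le> real N" "\<bar>inner x y0\<bar> \<le> real N" using x by (auto simp: F_def)
    moreover have "inner x y = inner x y0 + r * norm x"
      using False by (simp add: y_def inner_add_right power2_norm_eq_inner[symmetric] power2_eq_square)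
    ultimately have "r * norm x \<le> 2 * real N" by linarith
    then show ?thesis using r by (simp add: field_simps)
  qed (use r in simp)
  then show ?thesis by (auto simp: bounded_iff)
qed

text \<open>
  The sum \<open>M\<close> of the complements satisfies \<open>M\<^sup>\<bottom> \<subseteq> (\<Inter>i\<in>I. U i)\<close>, because each \<open>U i\<close> is its own
  bicomplement. If \<open>M\<close> is closed, the residual of projecting \<open>x \<in> (\<Inter>i\<in>I. U i)\<^sup>\<bottom>\<close> onto \<open>M\<close> therefore lies
  in the intersection, to which \<open>x\<close> is orthogonal, and so vanishes. The
  resulting decompositions of vectors come without control of the norms of the summands; uniform
  boundedness will make up for that.
\<close>

lemma orthogonal_comp_Inter_subset_sum:
  fixes U :: "'i \<Rightarrow> 'a::{real_inner, complete_space} set"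
  assumes fin: "finite I"
    and U: "\<And>i. i \<in> I \<Longrightarrow> subspace (U i)" "\<And>i. i \<in> I \<Longrightarrow> closed (U i)"
    and cl: "closed (\<Sum>i\<in>I. (U i)\<^sup>\<bottom>)"
  shows "(\<Inter>i\<in>I. U i)\<^sup>\<bottom> \<subseteq> (\<Sum>i\<in>I. (U i)\<^sup>\<bottom>)"
proof
  let ?W = "\<Inter>i\<in>I. U i" and ?M = "\<Sum>i\<in>I. (U i)\<^sup>\<bottom>"
  have M_eq: "?M = {sum s I |s. \<forall>i\<in>I. s i \<in> (U i)\<^sup>\<bottom>}" using fin by (rule set_sum_alt)
  have "subspace ?M"
    unfolding subspace_def
  proof (intro conjI ballI allI)
    show "0 \<in> ?M" unfolding M_eq
      by (rule CollectI, rule exI[of _ "\<lambda>_. 0"]) (simp add: subspace_0[OF subspace_orthogonal_comp])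
    show "a + b \<in> ?M" if "a \<in> ?M" "b \<in> ?M" for a b
    proof -
      from that obtain s t where "a = sum s I" "b = sum t I" "\<forall>i\<in>I. s i \<in> (U i)\<^sup>\<bottom>" "\<forall>i\<in>I. t i \<in> (U i)\<^sup>\<bottom>"
        unfolding M_eq by blast
      then show ?thesis unfolding M_eq
        by (intro CollectI exI[of _ "\<lambda>i. s i + t i"])
          (simp add: sum.distrib subspace_add[OF subspace_orthogonal_comp])
    qed
    show "c *\<^sub>R a \<in> ?M" if "a \<in> ?M" for c a
    proof -
      from that obtain s where "a = sum s I" "\<forall>i\<in>I. s i \<in> (U i)\<^sup>\<bottom>"
        unfolding M_eq by blast
      then show ?thesis unfolding M_eq
        by (intro CollectI exI[of _ "\<lambda>i. c *\<^sub>R s i"])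
          (simp add: scaleR_sum_right subspace_scale[OF subspace_orthogonal_comp])
    qed
  qed
  note M = this cl
  have summand: "(U i)\<^sup>\<bottom> \<subseteq> ?M" if "i \<in> I" for i
  proof
    fix y assume "y \<in> (U i)\<^sup>\<bottom>"
    then show "y \<in> ?M" unfolding M_eq using that fin
      by (intro CollectI exI[of _ "\<lambda>j. if j = i then y else 0"])
        (simp add: subspace_0[OF subspace_orthogonal_comp])
  qed
  fix x assume x: "x \<in> ?W\<^sup>\<bottom>"
  let ?r = "x - projector ?M x"
  have r: "?r \<in> ?M\<^sup>\<bottom>" by (rule projector_residual[OF M])
  have "?r \<in> U i" if "i \<in> I" for i
    using orthogonal_comp_anti_mono[OF summand[OF that]] r orthogonal_comp_self_Hilbert[OF U[OF that]]
    by blast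
  then have "?r \<in> ?W" by blast
  then have "inner x ?r = 0" using x by (auto simp: orthogonal_comp_iff)
  moreover have "inner ?r (projector ?M x) = 0"
    using r projector_in[OF M, of x] by (auto simp: orthogonal_comp_iff)
  ultimately have "inner ?r ?r = 0" by (simp add: inner_diff_left inner_diff_right inner_commute)
  then have "x = projector ?M x" by simp
  then show "x \<in> ?M" using projector_in[OF M, of x] by simp
qed

section \<open>Words of projections and reflections\<close>

abbreviation (input) proj_word :: "(nat \<Rightarrow> 'a::real_inner set) \<Rightarrow> nat list \<Rightarrow> 'a \<Rightarrow> 'a" where
  "proj_word U \<equiv> comp_word (\<lambda>i. projector (U i))"

abbreviation (input) refl_word :: "(nat \<Rightarrow> 'a::real_inner set) \<Rightarrow> nat list \<Rightarrow> 'a \<Rightarrow> 'a" where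
  "refl_word U \<equiv> comp_word (\<lambda>i. reflector (U i))"

context
  fixes U :: "nat \<Rightarrow> 'a::{real_inner, complete_space} set" and I :: "nat set"
  assumes closed_subspaces: "\<forall>i\<in>I. subspace (U i) \<and> closed (U i)"
begin

private lemma U: "i \<in> I \<Longrightarrow> subspace (U i)" "i \<in> I \<Longrightarrow> closed (U i)"
  using closed_subspaces by auto

lemma proj_word_linear: "set is \<subseteq> I \<Longrightarrow> linear (proj_word U is)"
proof (induction "is")
  case Nil then show ?case by (simp add: comp_word_simps id_def linear_ident)
next
  case (Cons i "is")
  then have "linear (proj_word U is \<circ> projector (U i))"
    by (intro linear_compose projector_linear U) auto
  then show ?case by (simp only: comp_word_simps)
qed

lemma norm_proj_word_le: "set is \<subseteq> I \<Longrightarrow> norm (proj_word U is x) \<le> norm x"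
proof (induction "is" arbitrary: x)
  case Nil then show ?case by (simp add: comp_word_simps)
next
  case (Cons i "is")
  then have "norm (proj_word U is (projector (U i) x)) \<le> norm (projector (U i) x)" by simp
  also have "\<dots> \<le> norm x" using Cons.prems by (simp add: norm_projector_le U)
  finally show ?case by (simp add: comp_word_simps)
qed

lemma proj_word_adjoint: "set is \<subseteq> I \<Longrightarrow> inner (proj_word U is x) y = inner x (proj_word U (rev is) y)"
proof (induction "is" arbitrary: x)
  case Nil then show ?case by (simp add: comp_word_simps)
next
  case (Cons i "is")
  then show ?case by (simp add: comp_word_simps comp_word_append projector_self_adjoint U)
qed

lemma proj_word_fixed: "set is \<subseteq> I \<Longrightarrow> x \<in> (\<Inter>i\<in>I. U i) \<Longrightarrow> proj_word U is x = x"
proof (induction "is")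
  case Nil then show ?case by (simp add: comp_word_simps)
next
  case (Cons i "is")
  then have "projector (U i) x = x" by (simp add: projector_fixed_iff U)
  with Cons show ?case by (simp add: comp_word_simps)
qed

text \<open>
  By Pythagoras the squared lengths of the successive displacements made by the projections of a word
  add up to the loss \<open>(norm x)\<^sup>2 - (norm (proj_word U is x))\<^sup>2\<close>. So a small loss means that every
  intermediate point, and hence \<open>x\<close> itself, is near to every \<open>U i\<close>. The factor \<open>2 ^ length is\<close> comes from
  using \<open>(s + t)\<^sup>2 \<le> 2 * s\<^sup>2 + 2 * t\<^sup>2\<close> once for each letter; any constant depending only on the word serves.
\<close>

lemma proj_word_defect:
  "set is \<subseteq> I \<Longrightarrow> i \<in> set is \<Longrightarrow>
    \<exists>u\<in>U i. (norm (x - u))\<^sup>2 \<le> 2 ^ length is * ((norm x)\<^sup>2 - (norm (proj_word U is x))\<^sup>2)"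
proof (induction "is" arbitrary: x)
  case Nil then show ?case by simp
next
  case (Cons j "is")
  define y where "y = projector (U j) x"
  have j: "subspace (U j)" "closed (U j)" using Cons.prems U by auto
  define a where "a = (norm (x - y))\<^sup>2"
  define b where "b = (norm y)\<^sup>2 - (norm (proj_word U is y))\<^sup>2"
  have a0: "a \<ge> 0" by (simp add: a_def)
  have b0: "b \<ge> 0" using norm_proj_word_le[of "is" y] Cons.prems by (simp add: b_def power_mono)
  have split: "(norm x)\<^sup>2 - (norm (proj_word U (j # is) x))\<^sup>2 = a + b"
    using norm_projector_Pythagoras[OF j, of x] by (simp add: a_def b_def y_def comp_word_simps)
  have "\<exists>u\<in>U i. (norm (x - u))\<^sup>2 \<le> 2 ^ length (j # is) * (a + b)"
  proof (cases "i = j")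
    case True
    have "1 * (a + b) \<le> 2 ^ length (j # is) * (a + b)"
      using a0 b0 by (intro mult_right_mono one_le_power) auto
    then have "a \<le> 2 ^ length (j # is) * (a + b)" using b0 by (simp del: length_Cons)
    then show ?thesis using True projector_in[OF j, of x] by (auto simp: a_def y_def intro!: bexI)
  next
    case False
    then obtain u where u: "u \<in> U i" "(norm (y - u))\<^sup>2 \<le> 2 ^ length is * b"
      using Cons.IH[of y] Cons.prems by (auto simp: b_def)
    have "(norm (x - u))\<^sup>2 \<le> (norm (x - y) + norm (y - u))\<^sup>2"
      by (intro power_mono) (use norm_triangle_ineq[of "x - y" "y - u"] in auto)
    also have "\<dots> \<le> 2 * a + 2 * (norm (y - u))\<^sup>2"
      using sum_squares_bound[of "norm (x - y)" "norm (y - u)"] by (simp add: a_def power2_sum)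
    also have "\<dots> \<le> 2 * (2 ^ length is * a) + 2 * (2 ^ length is * b)"
      using u(2) mult_right_mono[OF one_le_power[of "2::real" "length is"] a0] by simp
    finally show ?thesis using u(1) by (auto simp: algebra_simps)
  qed
  then show ?case by (simp add: split)
qed

lemma fixed_of_norm_proj_word_eq:
  assumes "set is \<subseteq> I" "i \<in> set is" "norm (proj_word U is x) = norm x"
  shows "x \<in> U i"
  using proj_word_defect[OF assms(1,2), of x] assms(3) by auto

text \<open>
  Consider the vectors of \<open>(\<Inter>i\<in>I. U i)\<^sup>\<bottom>\<close> whose loss of squared norm is at most one. Each of them is at
  bounded distance from every \<open>U i\<close>, so its inner product with a summand from \<open>(U i)\<^sup>\<bottom>\<close> is bounded by a
  constant times the norm of that summand. Since every \<open>y\<close> is a sum of such summands and of a vector of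
  the intersection, the set is weakly bounded, hence bounded, by \<open>K\<close> say. Rescaling gives
  \<open>(norm v)\<^sup>2 \<le> K\<^sup>2 * ((norm v)\<^sup>2 - (norm (A v))\<^sup>2)\<close> for the word operator \<open>A\<close>, which is the
  contraction with \<open>q = sqrt (1 - 1 / K\<^sup>2)\<close>.
\<close>

lemma proj_word_contracts:
  assumes "set is = I" and cl: "closed (\<Sum>i\<in>I. (U i)\<^sup>\<bottom>)"
  shows "\<exists>q. 0 \<le> q \<and> q < 1 \<and> (\<forall>v\<in>(\<Inter>i\<in>I. U i)\<^sup>\<bottom>. norm (proj_word U is v) \<le> q * norm v)"
proof -
  let ?W = "\<Inter>i\<in>I. U i" and ?A = "proj_word U is"
  have is_I: "set is \<subseteq> I" and fin: "finite I" using assms(1) by auto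
  define defect where "defect v = (norm v)\<^sup>2 - (norm (?A v))\<^sup>2" for v
  have defect0: "defect v \<ge> 0" for v
    using norm_proj_word_le[OF is_I, of v] by (simp add: defect_def power_mono)
  have W: "subspace ?W" "closed ?W" using U by (auto intro: subspace_Inter)
  define B where "B = {v \<in> ?W\<^sup>\<bottom>. defect v \<le> 1}"
  have "bounded B"
  proof (rule weakly_bounded_imp_bounded)
    fix y
    have "y - projector ?W y \<in> ?W\<^sup>\<bottom>" using projector_residual[OF W] .
    then obtain s where s: "y - projector ?W y = sum s I" "\<And>i. i \<in> I \<Longrightarrow> s i \<in> (U i)\<^sup>\<bottom>"
      using orthogonal_comp_Inter_subset_sum[OF fin U cl] set_sum_alt[OF fin, of "\<lambda>i. (U i)\<^sup>\<bottom>"] by auto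
    define c :: real where "c = sqrt (2 ^ length is)"
    have "\<bar>inner v y\<bar> \<le> (\<Sum>i\<in>I. c * norm (s i))" if v: "v \<in> B" for v
    proof -
      have "inner v (projector ?W y) = 0"
        using v projector_in[OF W, of y] by (auto simp: B_def orthogonal_comp_iff)
      then have "inner v y = inner v (y - projector ?W y)" by (simp add: inner_diff_right)
      also have "\<dots> = (\<Sum>i\<in>I. inner v (s i))" by (simp add: s(1) inner_sum_right)
      finally have "\<bar>inner v y\<bar> \<le> (\<Sum>i\<in>I. \<bar>inner v (s i)\<bar>)" by simp
      also have "\<dots> \<le> (\<Sum>i\<in>I. c * norm (s i))"
      proof (rule sum_mono)
        fix i assume i: "i \<in> I"
        then obtain u where u: "u \<in> U i" "(norm (v - u))\<^sup>2 \<le> 2 ^ length is * defect v"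
          using proj_word_defect[OF is_I, of i v] assms(1) by (auto simp: defect_def)
        have "2 ^ length is * defect v \<le> 2 ^ length is * 1"
          using v by (intro mult_left_mono) (auto simp: B_def)
        then have "norm (v - u) \<le> c" unfolding c_def using u(2) by (intro real_le_rsqrt) linarith
        moreover have "inner v (s i) = inner (v - u) (s i)"
          using s(2)[OF i] u(1) inner_commute[of u "s i"] by (simp add: orthogonal_comp_iff inner_diff_left)
        ultimately show "\<bar>inner v (s i)\<bar> \<le> c * norm (s i)"
          by (metis Cauchy_Schwarz_ineq2 mult_right_mono norm_ge_zero order_trans)
      qed
      finally show ?thesis .
    qed
    then show "\<exists>C. \<forall>v\<in>B. \<bar>inner v y\<bar> \<le> C" by blast
  qed
  then obtain K0 where K0: "\<forall>v\<in>B. norm v \<le> K0" by (auto simp: bounded_iff)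
  \<comment> \<open>At least \<open>1\<close>, so that \<open>1 - 1 / K\<^sup>2\<close> is nonnegative.\<close>
  define K where "K = max K0 1"
  have K1: "K \<ge> 1" and K: "\<And>v. v \<in> B \<Longrightarrow> norm v \<le> K" using K0 by (auto simp: K_def max_def)
  have scaled: "(norm v)\<^sup>2 \<le> K\<^sup>2 * defect v" if v: "v \<in> ?W\<^sup>\<bottom>" for v
  proof (cases "defect v = 0")
    case True
    then have "norm (?A v) = norm v" by (simp add: defect_def)
    then have "v \<in> ?W" using fixed_of_norm_proj_word_eq[OF is_I, of _ v] assms(1) by blast
    then have "inner v v = 0" using v by (simp only: orthogonal_comp_iff)
    then show ?thesis using True by simp
  next
    case False
    define t where "t = 1 / sqrt (defect v)"
    have pos: "defect v > 0" using False defect0[of v] by simp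
    then have t2: "t\<^sup>2 * defect v = 1" by (simp add: t_def power_divide)
    have "defect (t *\<^sub>R v) = t\<^sup>2 * defect v"
      using linear_scale[OF proj_word_linear[OF is_I]]
      by (simp add: defect_def power_mult_distrib algebra_simps)
    then have "t *\<^sub>R v \<in> B" using v t2 by (simp add: B_def subspace_scale[OF subspace_orthogonal_comp])
    from K[OF this] have "(norm (t *\<^sub>R v))\<^sup>2 \<le> K\<^sup>2" by (intro power_mono) auto
    then have "t\<^sup>2 * (norm v)\<^sup>2 * defect v \<le> K\<^sup>2 * defect v"
      using pos by (intro mult_right_mono) (auto simp: power_mult_distrib)
    then show ?thesis using t2 by (metis mult.commute mult.left_commute mult_1)
  qed
  define q where "q = sqrt (1 - 1 / K\<^sup>2)"
  have "1 / K\<^sup>2 \<le> 1" "1 / K\<^sup>2 > 0" using K1 by (auto simp: field_simps)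
  then have q: "0 \<le> q" "q < 1" "q\<^sup>2 = 1 - 1 / K\<^sup>2" by (auto simp: q_def)
  have "norm (?A v) \<le> q * norm v" if "v \<in> ?W\<^sup>\<bottom>" for v
  proof (rule power2_le_imp_le)
    have "(norm v)\<^sup>2 / K\<^sup>2 \<le> defect v" using scaled[OF that] K1 by (simp add: field_simps)
    then show "(norm (?A v))\<^sup>2 \<le> (q * norm v)\<^sup>2"
      by (simp add: power_mult_distrib q(3) defect_def algebra_simps)
  qed (simp add: q(1))
  then show ?thesis using q by blast
qed

text \<open>
  A reflector is self-adjoint and fixes \<open>w\<close>, so it can be moved onto \<open>w\<close> and disappears. The next lemmas
  follow: a word of reflectors moves \<open>x\<close> along a sphere around each point of the intersection,
  and it does not change the shadow of \<open>x\<close> on the intersection.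
\<close>

lemma inner_refl_word_fixed:
  "set is \<subseteq> I \<Longrightarrow> w \<in> (\<Inter>i\<in>I. U i) \<Longrightarrow> inner (refl_word U is x) w = inner x w"
proof (induction "is" arbitrary: x)
  case Nil then show ?case by (simp add: comp_word_simps)
next
  case (Cons i "is")
  then have "inner (reflector (U i) x) w = inner x w"
    using reflector_self_adjoint[OF U, of i x w] reflector_fixed[OF U, of i w] by simp
  with Cons show ?case by (simp add: comp_word_simps)
qed

lemma norm_refl_word: "set is \<subseteq> I \<Longrightarrow> norm (refl_word U is x) = norm x"
proof (induction "is" arbitrary: x)
  case Nil then show ?case by (simp add: comp_word_simps)
next
  case (Cons i "is")
  then show ?case by (simp add: comp_word_simps norm_reflector U)
qed

lemma dist_refl_word_fixed:
  assumes "set is \<subseteq> I" "w \<in> (\<Inter>i\<in>I. U i)"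
  shows "dist w (refl_word U is x) = dist w x"
proof -
  have "(dist w z)\<^sup>2 = (norm w)\<^sup>2 - 2 * inner z w + (norm z)\<^sup>2" for z
    unfolding dist_norm power2_norm_eq_inner
    by (simp add: inner_diff_left inner_diff_right inner_commute)
  then have "(dist w (refl_word U is x))\<^sup>2 = (dist w x)\<^sup>2"
    by (simp add: inner_refl_word_fixed[OF assms] norm_refl_word[OF assms(1)])
  then show ?thesis by simp
qed

lemma projector_refl_word:
  assumes "set is \<subseteq> I"
  shows "projector (\<Inter>i\<in>I. U i) (refl_word U is x) = projector (\<Inter>i\<in>I. U i) x"
proof -
  let ?W = "\<Inter>i\<in>I. U i"
  have W: "subspace ?W" "closed ?W" using U by (auto intro: subspace_Inter)
  show ?thesis
  proof (rule projector_eqI[OF W(1) projector_in[OF W]])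
    show "refl_word U is x - projector ?W x \<in> ?W\<^sup>\<bottom>"
      using projector_residual[OF W, of x] inner_refl_word_fixed[OF assms]
      unfolding orthogonal_comp_iff inner_diff_left by metis
  qed
qed

text \<open>
  Each projector is the average of the identity and the reflector. Expanding the product
  of these averages makes the word of projectors the average of the words of reflectors over all
  subwords; the two halves of the induction step are the subwords without and with the first letter.
\<close>

lemma proj_word_in_affine_hull:
  "set is \<subseteq> I \<Longrightarrow> sorted_wrt (<) is \<Longrightarrow>
    proj_word U is x \<in> affine hull {refl_word U js x |js. sorted_wrt (<) js \<and> set js \<subseteq> set is}"
proof (induction "is" arbitrary: x)
  case Nil then show ?case by (simp add: comp_word_simps hull_inc)
next
  case (Cons i "is")
  define E where "E = {refl_word U js x |js. sorted_wrt (<) js \<and> set js \<subseteq> set (i # is)}"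
  have without: "{refl_word U js x |js. sorted_wrt (<) js \<and> set js \<subseteq> set is} \<subseteq> E"
    by (auto simp: E_def)
  have "with": "{refl_word U js (reflector (U i) x) |js. sorted_wrt (<) js \<and> set js \<subseteq> set is} \<subseteq> E"
  proof clarify
    fix js assume js: "sorted_wrt (<) js" "set js \<subseteq> set is"
    then have "sorted_wrt (<) (i # js) \<and> set (i # js) \<subseteq> set (i # is)" using Cons.prems(2) by auto
    moreover have "refl_word U js (reflector (U i) x) = refl_word U (i # js) x"
      by (simp add: comp_word_simps)
    ultimately show "refl_word U js (reflector (U i) x) \<in> E" unfolding E_def by blast
  qed
  have "is": "set is \<subseteq> I" "sorted_wrt (<) is" using Cons.prems by auto
  have "proj_word U is x \<in> affine hull E" "proj_word U is (reflector (U i) x) \<in> affine hull E"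
    using Cons.IH[OF "is"] hull_mono[OF without] hull_mono[OF "with"] by blast+
  then have "(1/2) *\<^sub>R proj_word U is x + (1/2) *\<^sub>R proj_word U is (reflector (U i) x) \<in> affine hull E"
    by (intro mem_affine affine_affine_hull) auto
  also have "(1/2) *\<^sub>R proj_word U is x + (1/2) *\<^sub>R proj_word U is (reflector (U i) x)
      = proj_word U (i # is) x"
    using proj_word_linear[OF "is"(1)]
    by (simp add: comp_word_simps projector_eq_midpoint[of "U i" x] linear_add linear_scale)
  finally show ?case by (simp add: E_def)
qed

end

section \<open>Circumcenters\<close>

text \<open>
  One step of the Gram-Schmidt process for each vector of \<open>B\<close>: only the component \<open>e\<close> of the new vector
  orthogonal to the old span contributes. If \<open>e = 0\<close>, division by zero gives the right coefficient \<open>0\<close>.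
\<close>

lemma orthogonal_projection_on_finite_span:
  fixes x :: "'a::real_inner"
  assumes "finite B"
  shows "\<exists>p\<in>span B. x - p \<in> (span B)\<^sup>\<bottom>"
  using assms
proof (induction B arbitrary: x)
  case empty then show ?case by (simp add: orthogonal_comp_iff)
next
  case (insert b B)
  obtain pb where pb: "pb \<in> span B" "b - pb \<in> (span B)\<^sup>\<bottom>" using insert.IH by blast
  obtain px where px: "px \<in> span B" "x - px \<in> (span B)\<^sup>\<bottom>" using insert.IH by blast
  define e where "e = b - pb"
  define p where "p = px + (inner x e / inner e e) *\<^sub>R e"
  have sub: "span B \<subseteq> span (insert b B)" by (rule span_mono) blast
  have e: "e \<in> span (insert b B)"
    unfolding e_def by (rule span_diff) (use pb(1) sub in \<open>auto intro: span_base\<close>)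
  have p: "p \<in> span (insert b B)"
    unfolding p_def by (rule span_add) (use px(1) sub e in \<open>auto intro: span_scale\<close>)
  have eB: "inner e y = 0" if "y \<in> span B" for y
    using pb(2) that by (simp add: e_def orthogonal_comp_iff)
  have old: "inner (x - p) y = 0" if "y \<in> span B" for y
    using px(2) that eB[OF that] by (simp add: p_def orthogonal_comp_iff inner_diff_left inner_add_left)
  have "inner (x - p) e = 0"
    using eB[OF px(1)] inner_commute[of e px]
    by (cases "e = 0") (simp_all add: p_def inner_diff_left inner_add_left)
  then have new: "inner (x - p) b = 0"
    using old[OF pb(1)] by (simp add: e_def inner_diff_right)
  have "inner (x - p) z = 0" if z: "z \<in> span (insert b B)" for z
  proof -
    obtain k where "z - k *\<^sub>R b \<in> span B" using z by (auto simp: span_insert)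
    then have "inner (x - p) (z - k *\<^sub>R b) = 0" by (rule old)
    then show ?thesis using new by (simp add: inner_diff_right)
  qed
  then show ?case using p by (auto simp: orthogonal_comp_iff)
qed

text \<open>
  If \<open>w\<close> is equidistant from finitely many points, then so is its orthogonal projection \<open>p\<close> onto their
  affine hull, by Pythagoras. Two points of the hull equidistant from the generators differ by a vector
  that lies in the direction space and is orthogonal to it, so \<open>p\<close> is the circumcenter. Hence the
  circumcenter is the point of the hull nearest to \<open>w\<close>, and any convenient point \<open>y\<close> of the hull gives an
  upper bound.
\<close>

lemma circumcenter_map_nearest:
  fixes w :: "'a::real_inner"
  assumes S: "finite S" "S \<noteq> {}" and eq: "\<forall>G\<in>S. dist w (G x) = r"
  defines "K \<equiv> (\<lambda>G. G x) ` S"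
  shows circumcenter_map_in_affine_hull: "circumcenter_map S x \<in> affine hull K"
    and dist_circumcenter_map_le: "y \<in> affine hull K \<Longrightarrow> dist w (circumcenter_map S x) \<le> dist w y"
proof -
  have K: "finite K" and eqK: "\<And>y. y \<in> K \<Longrightarrow> dist w y = r" using S eq by (auto simp: K_def)
  obtain a where a: "a \<in> K" using S by (auto simp: K_def)
  define D where "D = span ((\<lambda>x. - a + x) ` K)"
  have aff: "affine hull K = (\<lambda>x. a + x) ` D"
    using affine_hull_insert_span_gen[of a K] a by (simp add: D_def insert_absorb)
  obtain d where d: "d \<in> D" "w - a - d \<in> D\<^sup>\<bottom>"
    using orthogonal_projection_on_finite_span[of "(\<lambda>x. - a + x) ` K" "w - a"] K by (auto simp: D_def)
  define p where "p = a + d"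
  have p: "p \<in> affine hull K" using d(1) by (auto simp: aff p_def)
  have diff: "u - v \<in> D" if uv: "u \<in> affine hull K" "v \<in> affine hull K" for u v
  proof -
    obtain u' v' where "u = a + u'" "v = a + v'" "u' \<in> D" "v' \<in> D" using uv unfolding aff by blast
    then show ?thesis by (simp add: D_def span_diff)
  qed
  have pyth: "(dist w y)\<^sup>2 = (dist w p)\<^sup>2 + (dist p y)\<^sup>2" if "y \<in> affine hull K" for y
  proof -
    have "inner (w - p) (p - y) = 0"
      using d(2) diff[OF p that] by (simp add: orthogonal_comp_iff p_def diff_diff_eq)
    then show ?thesis
      using norm_add_Pythagorean[of "w - p" "p - y"] by (simp add: dist_norm orthogonal_def)
  qed
  have p_eq: "dist p y = dist p z" if yz: "y \<in> K" "z \<in> K" for y z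
  proof -
    have "(dist p y)\<^sup>2 = (dist p z)\<^sup>2"
      using pyth[of y] pyth[of z] eqK yz by (simp add: hull_inc)
    then show ?thesis by simp
  qed
  have "circumcenter_map S x = p"
    unfolding circumcenter_map_def K_def[symmetric]
  proof (rule the_equality)
    show "p \<in> affine hull K \<and> (\<forall>y\<in>K. \<forall>z\<in>K. dist p y = dist p z)" using p p_eq by blast
    fix q assume q: "q \<in> affine hull K \<and> (\<forall>y\<in>K. \<forall>z\<in>K. dist q y = dist q z)"
    have "orthogonal (q - p) z" if z: "z \<in> (\<lambda>x. - a + x) ` K" for z
    proof -
      obtain y where y: "y \<in> K" "z = y - a" using z by auto
      have "(dist q y)\<^sup>2 = (dist q a)\<^sup>2" "(dist p y)\<^sup>2 = (dist p a)\<^sup>2"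
        using q a y(1) p_eq by metis+
      then show ?thesis
        unfolding orthogonal_def y(2) dist_norm power2_norm_eq_inner
        by (simp add: inner_diff_left inner_diff_right inner_commute)
    qed
    then have "orthogonal (q - p) (q - p)"
      using diff[of q p] p q orthogonal_to_span[of "q - p" "(\<lambda>x. - a + x) ` K" "q - p"]
      unfolding D_def by blast
    then show "q = p" by (simp add: orthogonal_self)
  qed
  moreover have "dist w p \<le> dist w y" if "y \<in> affine hull K" for y
    by (rule power2_le_imp_le) (simp_all add: pyth[OF that])
  ultimately show "circumcenter_map S x \<in> affine hull K"
    "y \<in> affine hull K \<Longrightarrow> dist w (circumcenter_map S x) \<le> dist w y"
    using p by simp_all
qed

section \<open>Symmetric operators and their numerical range\<close>

text \<open>
  Polarisation bounds \<open>4 * \<langle>B x, y\<rangle>\<close> by \<open>2 * e * ((norm x)\<^sup>2 + (norm y)\<^sup>2)\<close>; the inequality results from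
  choosing for \<open>y\<close> the multiple of \<open>B x\<close> whose norm is \<open>norm x\<close>.
\<close>

lemma norm_le_numerical_radius:
  fixes B :: "'a::real_inner \<Rightarrow> 'a"
  assumes B: "linear B" and V: "subspace V" and inv: "\<And>v. v \<in> V \<Longrightarrow> B v \<in> V"
    and sym: "\<And>u v. u \<in> V \<Longrightarrow> v \<in> V \<Longrightarrow> inner (B u) v = inner u (B v)"
    and rad: "\<And>v. v \<in> V \<Longrightarrow> \<bar>inner (B v) v\<bar> \<le> e * (norm v)\<^sup>2"
    and x: "x \<in> V"
  shows "norm (B x) \<le> e * norm x"
proof (cases "x = 0 \<or> B x = 0")
  case True
  have "0 \<le> e * (norm x)\<^sup>2" using rad[OF x] by (meson abs_ge_zero order_trans)
  then show ?thesis using True linear_0[OF B] by (auto simp: zero_le_mult_iff)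
next
  case False
  define y where "y = (norm x / norm (B x)) *\<^sub>R B x"
  have y: "y \<in> V" using V inv[OF x] by (simp add: y_def subspace_scale)
  have norm_y: "norm y = norm x" using False by (simp add: y_def)
  have "4 * inner (B x) y = inner (B (x + y)) (x + y) - inner (B (x - y)) (x - y)"
    using sym[OF x y] by (simp add: linear_add[OF B] linear_diff[OF B] inner_add_left inner_add_right
        inner_diff_left inner_diff_right inner_commute)
  also have "\<dots> \<le> e * (norm (x + y))\<^sup>2 + e * (norm (x - y))\<^sup>2"
    using rad[OF subspace_add[OF V x y]] rad[OF subspace_diff[OF V x y]] by linarith
  also have "\<dots> = e * ((norm (x + y))\<^sup>2 + (norm (x - y))\<^sup>2)" by (simp add: distrib_left)
  also have "(norm (x + y))\<^sup>2 + (norm (x - y))\<^sup>2 = 2 * (norm x)\<^sup>2 + 2 * (norm y)\<^sup>2"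
    unfolding power2_norm_eq_inner
    by (simp add: inner_add_left inner_add_right inner_diff_left inner_diff_right inner_commute)
  also have "e * \<dots> = 4 * e * (norm x)\<^sup>2" by (simp add: norm_y)
  also have "inner (B x) y = norm x * norm (B x)"
    using False by (simp add: y_def power2_norm_eq_inner[symmetric] power2_eq_square)
  finally show ?thesis using False by (simp add: power2_eq_square)
qed

text \<open>
  The relaxation \<open>(1 - l) Id + l T\<close> maps the numerical range \<open>[c1, c2]\<close> affinely, and \<open>l = 2 / (2 - c1 - c2)\<close>
  is the parameter for which the image is symmetric about zero; its right end is then the rate.
\<close>

lemma relaxation_norm_le:
  fixes T :: "'a::real_inner \<Rightarrow> 'a"
  assumes T: "linear T" and V: "subspace V" and inv: "\<And>v. v \<in> V \<Longrightarrow> T v \<in> V"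
    and sym: "\<And>u v. u \<in> V \<Longrightarrow> v \<in> V \<Longrightarrow> inner (T u) v = inner u (T v)"
    and lower: "\<And>v. v \<in> V \<Longrightarrow> c1 * (norm v)\<^sup>2 \<le> inner (T v) v"
    and upper: "\<And>v. v \<in> V \<Longrightarrow> inner (T v) v \<le> c2 * (norm v)\<^sup>2"
    and less: "c1 + c2 < 2" and x: "x \<in> V"
  defines "l \<equiv> 2 / (2 - c1 - c2)"
  shows "norm ((1 - l) *\<^sub>R x + l *\<^sub>R T x) \<le> (c2 - c1) / (2 - c1 - c2) * norm x"
proof -
  let ?B = "\<lambda>x. (1 - l) *\<^sub>R x + l *\<^sub>R T x"
  let ?e = "(c2 - c1) / (2 - c1 - c2)"
  have affine_value: "1 - l + l * c = (2 * c - c1 - c2) / (2 - c1 - c2)" for c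
  proof -
    have divide_cancel: "2 / d * d = 2" if "d \<noteq> 0" for d :: real using that by simp
    have "l * (2 - c1 - c2) = 2"
      unfolding l_def by (rule divide_cancel) (use less in linarith)
    moreover have "(1 - l + l * c) * (2 - c1 - c2)
        = (2 - c1 - c2) - l * (2 - c1 - c2) + c * (l * (2 - c1 - c2))"
      by (simp add: algebra_simps)
    ultimately have "(1 - l + l * c) * (2 - c1 - c2) = 2 * c - c1 - c2" by simp
    then show ?thesis using less by (simp add: eq_divide_eq)
  qed
  have l: "l \<ge> 0" "1 - l + l * c2 = ?e" "1 - l + l * c1 = - ?e"
    using less affine_value[of c2] affine_value[of c1]
    by (simp_all add: l_def minus_divide_left)
  show ?thesis
  proof (rule norm_le_numerical_radius[where B = ?B and V = V and x = x])
    show "linear ?B" by (intro linear_compose_add linear_compose_scale_right linear_ident T)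
    show "?B v \<in> V" if "v \<in> V" for v using that V inv by (simp add: subspace_add subspace_scale)
    show "inner (?B u) v = inner u (?B v)" if "u \<in> V" "v \<in> V" for u v
      using sym[OF that] by (simp add: inner_add_left inner_add_right)
    fix v assume v: "v \<in> V"
    have split: "inner (?B v) v = (1 - l) * (norm v)\<^sup>2 + l * inner (T v) v"
      by (simp add: inner_add_left power2_norm_eq_inner)
    have "l * (c1 * (norm v)\<^sup>2) \<le> l * inner (T v) v" "l * inner (T v) v \<le> l * (c2 * (norm v)\<^sup>2)"
      using l(1) lower[OF v] upper[OF v] by (auto intro: mult_left_mono)
    moreover have "(1 - l) * (norm v)\<^sup>2 + l * (c1 * (norm v)\<^sup>2) = - ?e * (norm v)\<^sup>2"
      unfolding l(3)[symmetric] by (simp add: algebra_simps)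
    moreover have "(1 - l) * (norm v)\<^sup>2 + l * (c2 * (norm v)\<^sup>2) = ?e * (norm v)\<^sup>2"
      unfolding l(2)[symmetric] by (simp add: algebra_simps)
    ultimately show "\<bar>inner (?B v) v\<bar> \<le> ?e * (norm v)\<^sup>2" unfolding split by linarith
  qed (use V x in auto)
qed

text \<open>
  The infimum and the supremum over the unit sphere turn by homogeneity into quadratic form bounds on
  all of \<open>V\<close>. The value \<open>0\<close> for \<open>V = {0}\<close>, where the sphere is empty, is compatible with them.
\<close>

lemma numerical_range_bounds:
  fixes T :: "'a::real_inner \<Rightarrow> 'a"
  assumes T: "linear T" and V: "subspace V"
    and pos: "\<forall>v\<in>V. 0 \<le> inner (T v) v"
    and le: "\<forall>v\<in>V. inner (T v) v \<le> b * (norm v)\<^sup>2" and b: "0 \<le> b"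
    and c1: "c1 = (if V = {0} then 0 else Inf {inner (T x) x |x. x \<in> V \<and> norm x = 1})"
    and c2: "c2 = (if V = {0} then 0 else Sup {inner (T x) x |x. x \<in> V \<and> norm x = 1})"
  shows "0 \<le> c1" "c1 \<le> c2" "c2 \<le> b"
    and "v \<in> V \<Longrightarrow> c1 * (norm v)\<^sup>2 \<le> inner (T v) v"
    and "v \<in> V \<Longrightarrow> inner (T v) v \<le> c2 * (norm v)\<^sup>2"
proof -
  let ?N = "{inner (T x) x |x. x \<in> V \<and> norm x = 1}"
  have bdd: "bdd_below ?N" "bdd_above ?N"
    using pos le by (fastforce intro!: bdd_belowI[of _ 0] bdd_aboveI[of _ b])+
  have unit: "(1 / norm v) *\<^sub>R v \<in> V \<and> norm ((1 / norm v) *\<^sub>R v) = 1" if "v \<in> V" "v \<noteq> 0" for v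
    using that V by (simp add: subspace_scale)
  have both: "c1 * (norm v)\<^sup>2 \<le> inner (T v) v \<and> inner (T v) v \<le> c2 * (norm v)\<^sup>2" if v: "v \<in> V" for v
  proof (cases "v = 0")
    case True
    then show ?thesis using linear_0[OF T] by simp
  next
    case False
    let ?u = "(1 / norm v) *\<^sub>R v"
    have "inner (T ?u) ?u \<in> ?N" using unit[OF v False] by blast
    moreover have "V \<noteq> {0}" using v False by blast
    ultimately have "c1 \<le> inner (T ?u) ?u \<and> inner (T ?u) ?u \<le> c2"
      using bdd unfolding c1 c2 by (simp_all only: if_False cInf_lower cSup_upper)
    also have "inner (T ?u) ?u = inner (T v) v / (norm v)\<^sup>2"
      by (simp add: linear_scale[OF T] power2_eq_square)
    finally show ?thesis using False by (simp add: field_simps)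
  qed
  then show "v \<in> V \<Longrightarrow> c1 * (norm v)\<^sup>2 \<le> inner (T v) v"
    "v \<in> V \<Longrightarrow> inner (T v) v \<le> c2 * (norm v)\<^sup>2" by auto
  have "0 \<le> c1 \<and> c1 \<le> c2 \<and> c2 \<le> b"
  proof (cases "V = {0}")
    case True then show ?thesis using b by (simp add: c1 c2)
  next
    case False
    then obtain v where "v \<in> V" "v \<noteq> 0" using subspace_0[OF V] by blast
    then obtain u where u: "u \<in> V" "norm u = 1" using unit by blast
    then have ne: "?N \<noteq> {}" by blast
    have "0 \<le> c1" using False ne pos by (auto simp: c1 intro!: cInf_greatest)
    moreover have "c2 \<le> b" using False ne by (auto simp: c2 intro!: cSup_least dest: bspec[OF le])
    moreover have "c1 \<le> c2" using both[OF u(1)] u(2) by simp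
    ultimately show ?thesis by simp
  qed
  then show "0 \<le> c1" "c1 \<le> c2" "c2 \<le> b" by auto
qed

section \<open>The linear rate of the circumcenter iteration\<close>

text \<open>
  The rate decreases as \<open>c1\<close> grows from \<open>0\<close> to \<open>c2\<close>, so its worst case is \<open>c1 = 0\<close>.
\<close>

lemma rate_bounds:
  fixes c1 c2 :: real
  assumes "0 \<le> c1" "c1 \<le> c2" "c2 < 1"
  shows "0 \<le> (c2 - c1) / (2 - c1 - c2)"
    and "(c2 - c1) / (2 - c1 - c2) \<le> c2 / (2 - c2)"
    and "c2 / (2 - c2) \<le> c2"
proof -
  have pos: "0 < 2 - c1 - c2" "0 < 2 - c2" using assms by auto
  show "0 \<le> (c2 - c1) / (2 - c1 - c2)" using assms pos by simp
  have "c1 * c2 \<le> c1" using assms mult_left_mono[of c2 1 c1] by simp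
  then have "(c2 - c1) * (2 - c2) \<le> c2 * (2 - c1 - c2)" by (simp add: algebra_simps)
  then show "(c2 - c1) / (2 - c1 - c2) \<le> c2 / (2 - c2)"
    using pos by (simp add: frac_le_eq divide_le_eq pos_divide_le_eq pos_le_divide_eq mult.commute)
  show "c2 / (2 - c2) \<le> c2"
    using assms pos mult_left_mono[of 1 "2 - c2" c2] by (simp add: pos_divide_le_eq)
qed

text \<open>
  Composing with the projector onto \<open>V\<close> makes the operator norm the best constant of \<open>L\<close> on \<open>V\<close>,
  because the projector does not increase norms and fixes \<open>V\<close>.
\<close>

lemma onorm_comp_projector:
  fixes L :: "'a::{real_inner, complete_space} \<Rightarrow> 'a"
  assumes V: "subspace V" "closed V" and L: "linear L" and b0: "0 \<le> b"
    and bound: "\<forall>v\<in>V. norm (L v) \<le> b * norm v"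
  shows onorm_comp_projector_le: "onorm (L \<circ> projector V) \<le> b"
    and onorm_comp_projector_nonneg: "0 \<le> onorm (L \<circ> projector V)"
    and norm_le_onorm_comp_projector: "v \<in> V \<Longrightarrow> norm (L v) \<le> onorm (L \<circ> projector V) * norm v"
proof -
  have le: "norm ((L \<circ> projector V) x) \<le> b * norm x" for x
  proof -
    have "norm (L (projector V x)) \<le> b * norm (projector V x)" using bound projector_in[OF V] by blast
    also have "\<dots> \<le> b * norm x" using b0 by (intro mult_left_mono norm_projector_le V)
    finally show ?thesis by simp
  qed
  then show "onorm (L \<circ> projector V) \<le> b" by (rule onorm_bound[OF b0])
  have "linear (L \<circ> projector V)" by (intro linear_compose projector_linear V L)
  then have bl: "bounded_linear (L \<circ> projector V)"
    using le by (auto simp: bounded_linear_def bounded_linear_axioms_def mult.commute)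
  then show "0 \<le> onorm (L \<circ> projector V)" by (rule onorm_pos_le)
  show "norm (L v) \<le> onorm (L \<circ> projector V) * norm v" if "v \<in> V"
    using onorm[OF bl, of v] projector_fixed_iff[OF V, of v] that by simp
qed

theorem theorem6p8:
  fixes U :: "nat \<Rightarrow> 'a::{real_inner, complete_space} set"
    and n m :: nat
    and S :: "('a \<Rightarrow> 'a) set"
    and T :: "'a \<Rightarrow> 'a"
    and cT \<gamma> c1 c2 \<eta> :: real
  assumes n: "n \<noteq> 0"
    and m_def: "m = 2 * n - 1"
    and subspace_U: "\<And>i. i \<in> {1..n} \<Longrightarrow> subspace (U i)"
    and closed_U: "\<And>i. i \<in> {1..n} \<Longrightarrow> closed (U i)"
    and closed_sum: "closed (\<Sum>i=1..n. orthogonal_comp (U i))"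
    and U_refl: "\<And>i. i \<in> {1..n-1} \<Longrightarrow> U (n + i) = U (n - i)"
    and finite_S: "finite S"
    and Psi_S: "Psi_set U m \<subseteq> S"
    and S_Omega: "S \<subseteq> Omega_set U m"
    and T_def: "T = comp_word (\<lambda>i. projector (U i)) [1..<Suc m]"
    and cT_def: "cT = onorm (T \<circ> projector (orthogonal_comp (Fix T)))"
    and \<gamma>_def: "\<gamma> = onorm (comp_word (\<lambda>i. projector (U i)) [1..<Suc n] \<circ>
                        projector (orthogonal_comp (\<Inter>i\<in>{1..m}. U i)))"
    and c1_def: "c1 = (if orthogonal_comp (Fix T) = {0} then 0
                       else Inf {inner (T x) x | x. x \<in> orthogonal_comp (Fix T) \<and> norm x = 1})"
    and c2_def: "c2 = (if orthogonal_comp (Fix T) = {0} then 0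
                       else Sup {inner (T x) x | x. x \<in> orthogonal_comp (Fix T) \<and> norm x = 1})"
    and \<eta>_def: "\<eta> = (c2 - c1) / (2 - c1 - c2)"
  shows "(0 \<le> \<eta> \<and> \<eta> \<le> cT / (2 - cT) \<and> cT / (2 - cT) \<le> cT \<and> cT = \<gamma>\<^sup>2 \<and> \<gamma>\<^sup>2 < 1) \<and>
         (\<forall>x k. norm ((circumcenter_map S ^^ k) x - projector (\<Inter>i\<in>{1..n}. U i) x)
                \<le> \<eta> ^ k * norm (x - projector (\<Inter>i\<in>{1..n}. U i) x))"
proof -
  define A where "A = proj_word U [1..<Suc n]"
  define W where "W = (\<Inter>i\<in>{1..n}. U i)"
  define V where "V = W\<^sup>\<bottom>"
  have mirror: "\<exists>j\<in>{1..n}. U i = U j" if i: "i \<in> {1..m}" for i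
  proof (cases "i \<le> n")
    case False
    then have "i - n \<in> {1..n-1}" "n - (i - n) \<in> {1..n}" using i by (auto simp: m_def)
    moreover have "n + (i - n) = i" using False by simp
    ultimately show ?thesis using U_refl by metis
  qed (use i in auto)
  have n_le_m: "n \<le> m" using n by (simp add: m_def)
  have W_m: "(\<Inter>i\<in>{1..m}. U i) = W"
  proof
    show "(\<Inter>i\<in>{1..m}. U i) \<subseteq> W" unfolding W_def using n_le_m by (intro INF_superset_mono) auto
    show "W \<subseteq> (\<Inter>i\<in>{1..m}. U i)" unfolding W_def using mirror by blast
  qed
  have Un: "\<forall>i\<in>{1..n}. subspace (U i) \<and> closed (U i)" using subspace_U closed_U by blast
  then have Um: "\<forall>i\<in>{1..m}. subspace (U i) \<and> closed (U i)" using mirror by metis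
  have W: "subspace W" "closed W" using Un by (auto simp: W_def intro: subspace_Inter)
  have V: "subspace V" "closed V"
    unfolding V_def by (rule subspace_orthogonal_comp, rule closed_orthogonal_comp)
  have words: "set [1..<Suc n] \<subseteq> {1..n}" "set [1..<n] \<subseteq> {1..n}" "set [1..<Suc m] \<subseteq> {1..m}" "n \<in> {1..n}"
    using n by auto
  have T_linear: "linear T" unfolding T_def by (rule proj_word_linear[OF Um words(3)])
  have A_linear: "linear A" unfolding A_def by (rule proj_word_linear[OF Un words(1)])
  \<comment> \<open>The palindrome makes \<open>T\<close> equal to \<open>A\<^sup>* A\<close>; the middle projector is idempotent and is shared by both factors.\<close>
  have T_inner: "inner (T x) y = inner (A x) (A y)" for x y
  proof -
    have A: "A z = projector (U n) (proj_word U [1..<n] z)" for z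
      using n by (simp add: A_def comp_word_append comp_word_simps)
    have "T = proj_word U ([1..<n] @ [n] @ rev [1..<n])"
      unfolding T_def m_def using n U_refl by (intro comp_word_palindrome) auto
    then have "T x = proj_word U (rev [1..<n]) (A x)"
      by (simp only: A comp_word_append comp_word_simps comp_apply id_apply)
    then have "inner (T x) y = inner (A x) (proj_word U [1..<n] y)"
      using proj_word_adjoint[OF Un, of "rev [1..<n]"] words(2) by simp
    then show ?thesis unfolding A by (rule trans[OF _ inner_projector_left[OF subspace_U closed_U, OF words(4) words(4)]])
  qed
  have T_sym: "inner (T x) y = inner x (T y)" for x y
    using T_inner[of x y] T_inner[of y x] by (simp add: inner_commute)
  have T_W: "T w = w" if "w \<in> W" for w
    unfolding T_def by (rule proj_word_fixed[OF Um words(3), unfolded W_m, OF that])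
  have Fix_T: "Fix T = W"
  proof
    show "Fix T \<subseteq> W"
    proof
      fix x assume "x \<in> Fix T"
      then have eq: "norm (T x) = norm x" by (simp add: Fix_def)
      have "x \<in> U i" if "i \<in> {1..m}" for i
        by (rule fixed_of_norm_proj_word_eq[OF Um words(3), folded T_def])
          (use that eq in auto)
      then show "x \<in> W" by (auto simp flip: W_m)
    qed
  qed (use T_W in \<open>auto simp: Fix_def\<close>)
  have T_V: "T v \<in> V" if "v \<in> V" for v
    using that T_sym[of v] T_W by (auto simp: V_def orthogonal_comp_iff)

  have all_letters: "set [1..<Suc n] = {1..n}" by auto
  obtain q where q: "0 \<le> q" "q < 1" "\<forall>v\<in>V. norm (A v) \<le> q * norm v"
    using proj_word_contracts[OF Un all_letters closed_sum] unfolding V_def W_def A_def by blast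
  have \<gamma>: "\<gamma> = onorm (A \<circ> projector V)" unfolding \<gamma>_def W_m V_def A_def ..
  note A_onorm = onorm_comp_projector[OF V A_linear q(1,3), folded \<gamma>]
  have T_le: "norm (T v) \<le> 1 * norm v" for v
    unfolding T_def mult_1 by (rule norm_proj_word_le[OF Um words(3)])
  have cT: "cT = onorm (T \<circ> projector V)" unfolding cT_def Fix_T V_def ..
  note T_onorm = onorm_comp_projector[OF V T_linear zero_le_one, folded cT]
  have pos: "\<forall>v\<in>V. 0 \<le> inner (T v) v" by (simp add: T_inner)
  have upper: "\<forall>v\<in>V. inner (T v) v \<le> \<gamma>\<^sup>2 * (norm v)\<^sup>2"
  proof
    fix v assume "v \<in> V"
    then show "inner (T v) v \<le> \<gamma>\<^sup>2 * (norm v)\<^sup>2"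
      using power_mono[OF A_onorm(3), of v 2]
      by (simp add: T_inner power_mult_distrib power2_norm_eq_inner)
  qed
  note range = numerical_range_bounds[OF T_linear V(1) pos upper zero_le_power2
      c1_def[unfolded Fix_T, folded V_def] c2_def[unfolded Fix_T, folded V_def]]
  \<comment> \<open>The circle \<open>cT \<le> c2 \<le> \<gamma>\<^sup>2 \<le> cT\<close> identifies the three constants.\<close>
  have "cT \<le> c2"
  proof (rule onorm_comp_projector_le[OF V T_linear, folded cT])
    show "0 \<le> c2" using range(1,2) by simp
    show "\<forall>v\<in>V. norm (T v) \<le> c2 * norm v"
    proof (rule ballI, rule norm_le_numerical_radius[OF T_linear V(1) T_V T_sym])
      show "\<bar>inner (T v) v\<bar> \<le> c2 * (norm v)\<^sup>2" if "v \<in> V" for v using pos range(5)[OF that] that by simp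
    qed
  qed
  moreover have "\<gamma>\<^sup>2 \<le> cT"
  proof -
    have T_bound: "norm (T v) \<le> cT * norm v" if "v \<in> V" for v using T_onorm(3) T_le that by simp
    have cT0: "0 \<le> cT" using T_onorm(2) T_le by simp
    have "norm (A v) \<le> sqrt cT * norm v" if v: "v \<in> V" for v
    proof (rule power2_le_imp_le)
      have "(norm (A v))\<^sup>2 = inner (T v) v" by (simp add: T_inner power2_norm_eq_inner)
      also have "\<dots> \<le> norm (T v) * norm v" by (rule norm_cauchy_schwarz)
      also have "\<dots> \<le> (cT * norm v) * norm v" using T_bound[OF v] by (intro mult_right_mono) auto
      also have "\<dots> = (sqrt cT * norm v)\<^sup>2" using cT0 by (simp add: power_mult_distrib power2_eq_square)
      finally show "(norm (A v))\<^sup>2 \<le> (sqrt cT * norm v)\<^sup>2" .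
    qed (simp add: cT0)
    then have "\<gamma> \<le> sqrt cT"
      using onorm_comp_projector_le[OF V A_linear, of "sqrt cT", folded \<gamma>] cT0 by simp
    then show ?thesis using A_onorm(2) cT0 by (metis power_mono real_sqrt_pow2)
  qed
  ultimately have c: "cT = \<gamma>\<^sup>2" "c2 = \<gamma>\<^sup>2" using range(3) by simp_all
  have \<gamma>1: "\<gamma>\<^sup>2 < 1"
    using A_onorm(1,2) q(2) by (simp add: power_less_one_iff abs_square_less_1)
  have part1: "0 \<le> \<eta> \<and> \<eta> \<le> cT / (2 - cT) \<and> cT / (2 - cT) \<le> cT \<and> cT = \<gamma>\<^sup>2 \<and> \<gamma>\<^sup>2 < 1"
    using rate_bounds[of c1 c2] range(1,2) c \<gamma>1 by (simp add: \<eta>_def)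

  define l where "l = 2 / (2 - c1 - c2)"
  have step: "projector W (circumcenter_map S x) = projector W x \<and>
      norm (circumcenter_map S x - projector W x) \<le> \<eta> * norm (x - projector W x)" for x
  proof -
    define w where "w = projector W x"
    define K where "K = (\<lambda>G. G x) ` S"
    have wW: "w \<in> W" unfolding w_def by (rule projector_in[OF W])
    have orbit: "dist w (G x) = dist w x \<and> projector W (G x) = w" if G: "G \<in> S" for G
    proof -
      obtain "is" where "G = refl_word U is" "set is \<subseteq> {1..m}"
        using G S_Omega by (auto simp: Omega_set_def)
      then show ?thesis
        using dist_refl_word_fixed[OF Um, unfolded W_m, of "is" w]
          projector_refl_word[OF Um, unfolded W_m, of "is"] wW
        by (simp add: w_def)
    qed
    have subwords: "{refl_word U js x |js. sorted_wrt (<) js \<and> set js \<subseteq> set is} \<subseteq> K"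
      if "set is \<subseteq> {1..m}" for "is"
    proof clarify
      fix js assume js: "sorted_wrt (<) js" "set js \<subseteq> set is"
      then have sub: "set js \<subseteq> {1..m}" using that by blast
      have "distinct js" using js(1) strict_sorted_iff by blast
      then have "length js \<le> m" using card_mono[OF _ sub] by (simp add: distinct_card)
      then have "refl_word U js \<in> S" using Psi_S sub js(1) by (auto simp: Psi_set_def)
      then show "refl_word U js x \<in> K" by (auto simp: K_def)
    qed
    have "sorted_wrt (<) [1..<Suc m]" by (rule sorted_wrt_upt)
    then have "T x \<in> affine hull K"
      unfolding T_def
      using proj_word_in_affine_hull[OF Um words(3)] hull_mono[OF subwords[OF words(3)]] by blast
    moreover have xK: "x \<in> K"
      using subwords[of "[]"] by (auto simp: comp_word_simps)
    \<comment> \<open>Both \<open>x\<close>, from the empty word, and \<open>T x\<close> lie in the hull, hence so does the optimal relaxation.\<close>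
    ultimately have y: "(1 - l) *\<^sub>R x + l *\<^sub>R T x \<in> affine hull K" (is "?y \<in> _")
      by (intro mem_affine affine_affine_hull) (auto intro: hull_inc)
    have S_ne: "S \<noteq> {}" using xK by (auto simp: K_def)
    have "\<forall>G\<in>S. dist w (G x) = dist w x" using orbit by blast
    note CC = circumcenter_map_nearest[OF finite_S S_ne this, folded K_def]
    have "affine {z. projector W z = w}"
      unfolding affine_def
      using projector_linear[OF W] by (auto simp: linear_add linear_scale simp flip: scaleR_add_left)
    then have "affine hull K \<subseteq> {z. projector W z = w}"
      using orbit by (intro hull_minimal) (auto simp: K_def)
    then have shadow: "projector W (circumcenter_map S x) = w" using CC(1) by blast
    have xV: "x - w \<in> V" unfolding w_def V_def by (rule projector_residual[OF W])
    have "norm (circumcenter_map S x - w) \<le> norm (?y - w)"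
      using CC(2)[OF y] by (simp add: dist_norm norm_minus_commute)
    also have "?y - w = (1 - l) *\<^sub>R (x - w) + l *\<^sub>R T (x - w)"
      using T_W[OF wW] by (simp add: linear_diff[OF T_linear] algebra_simps)
    also have "norm \<dots> \<le> \<eta> * norm (x - w)"
      unfolding \<eta>_def l_def
      by (rule relaxation_norm_le[OF T_linear V(1) T_V T_sym range(4,5) _ xV])
        (use range(2) c \<gamma>1 in auto)
    finally show ?thesis using shadow by (simp add: w_def)
  qed
  have "projector W ((circumcenter_map S ^^ k) x) = projector W x \<and>
      norm ((circumcenter_map S ^^ k) x - projector W x) \<le> \<eta> ^ k * norm (x - projector W x)" for x k
  proof (induction k)
    case (Suc k)
    let ?z = "(circumcenter_map S ^^ k) x"
    have "norm (circumcenter_map S ?z - projector W x) \<le> \<eta> * norm (?z - projector W x)"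
      using step[of ?z] Suc by simp
    also have "\<dots> \<le> \<eta> * (\<eta> ^ k * norm (x - projector W x))"
      using Suc part1 by (intro mult_left_mono) auto
    finally show ?case using step[of ?z] Suc by simp
  qed simp
  then show ?thesis using part1 unfolding W_def[symmetric] by blast
qed

end
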